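(* Let $(\mathbb{R}^n,g)$ be a pseudo-Euclidean space, $n\ge3$, with coordinates $x=(x_1,\dots,x_n)$ and $g_{ij}=\delta_{ij}\varepsilon_i$, $1\le i,j\le n$, where $\varepsilon_i=\pm1$. Let $\rho\in\mathbb{R}$, $\rho\ne0$, and let $\bar g=\frac{1}{\psi^2}g$, where $\psi=\psi(r)$ is a smooth function of $r=\sum_{k=1}^n\varepsilon_kx_k^2$. Then $(\mathbb{R}^n,\bar g)$ is a steady gradient $\rho$-Einstein soliton with scalar curvature $K_{\bar g}=0$ and with a smooth function $h(r)$ as a potential function if and only if $(\mathbb{R}^n,\bar g)$ is flat.
   Context: A semi-Riemannian manifold $(M^n,\bar g)$, $n\ge3$, is a gradient $\rho$-Einstein soliton ($\rho\in\mathbb{R}$, $\rho\ne0$) with potential function $h$ (a smooth function $h:M\to\mathbb{R}$) if $\mathrm{Ric}_{\bar g}+\mathrm{Hess}_{\bar g}h=\rho K_{\bar g}\,\bar g+\lambda\bar g$ for some constant $\lambda\in\mathbb{R}$, where $K_{\bar g}$ is the scalar curvature of $\bar g$. It is called steady if $\lambda=0$. The notation $\psi(r)$, $h(r)$ means that the functions depend on $x$ only through $r$. *)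

theory Defs
  imports "HOL-Analysis.Analysis"
begin

definition pd :: "'n::finite \<Rightarrow> (real^'n \<Rightarrow> real) \<Rightarrow> real^'n \<Rightarrow> real"
  where "pd i f x = frechet_derivative f (at x) (axis i 1)"

primrec continuously_diff :: "nat \<Rightarrow> (real^'n::finite \<Rightarrow> real) \<Rightarrow> bool"
  where
    "continuously_diff 0 f \<longleftrightarrow> continuous_on UNIV f"
  | "continuously_diff (Suc k) f \<longleftrightarrow>
       (\<forall>x. f differentiable (at x)) \<and> (\<forall>i. continuously_diff k (pd i f))"

definition smooth :: "(real^'n::finite \<Rightarrow> real) \<Rightarrow> bool"
  where "smooth f \<longleftrightarrow> (\<forall>k. continuously_diff k f)"

text \<open>
  A metric on \<open>\<real>\<^sup>n\<close> is given by its matrix of components in the standard global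
  coordinates. Its index is locally constant by nondegeneracy and continuity, hence
  constant, so constancy of the index is not demanded separately.
\<close>

definition semi_riemannian_metric :: "(real^'n::finite \<Rightarrow> real^'n^'n) \<Rightarrow> bool"
  where "semi_riemannian_metric G \<longleftrightarrow>
    (\<forall>i j. smooth (\<lambda>x. G x $ i $ j)) \<and>
    (\<forall>x. transpose (G x) = G x \<and> invertible (G x))"

text \<open>\<open>christoffel G k i j\<close> is the Levi-Civita symbol \<open>\<Gamma>\<close> with upper index \<open>k\<close> and
  lower indices \<open>i\<close>, \<open>j\<close>.\<close>

definition christoffel ::
    "(real^'n::finite \<Rightarrow> real^'n^'n) \<Rightarrow> 'n \<Rightarrow> 'n \<Rightarrow> 'n \<Rightarrow> real^'n \<Rightarrow> real"
  where "christoffel G k i j x =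
    (1/2) * (\<Sum>l\<in>UNIV. matrix_inv (G x) $ k $ l *
      (pd i (\<lambda>y. G y $ j $ l) x + pd j (\<lambda>y. G y $ i $ l) x - pd l (\<lambda>y. G y $ i $ j) x))"

text \<open>\<open>riemann G l i j k\<close> is the \<open>l\<close>-th component of \<open>R(\<partial>\<^sub>i, \<partial>\<^sub>j) \<partial>\<^sub>k\<close>, where
  \<open>R(X, Y) Z = \<nabla>\<^sub>X \<nabla>\<^sub>Y Z - \<nabla>\<^sub>Y \<nabla>\<^sub>X Z - \<nabla>\<^bsub>[X, Y]\<^esub> Z\<close>.\<close>

definition riemann ::
    "(real^'n::finite \<Rightarrow> real^'n^'n) \<Rightarrow> 'n \<Rightarrow> 'n \<Rightarrow> 'n \<Rightarrow> 'n \<Rightarrow> real^'n \<Rightarrow> real"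
  where "riemann G l i j k x =
    pd i (christoffel G l j k) x - pd j (christoffel G l i k) x +
    (\<Sum>m\<in>UNIV. christoffel G l i m x * christoffel G m j k x -
               christoffel G l j m x * christoffel G m i k x)"

definition flat :: "(real^'n::finite \<Rightarrow> real^'n^'n) \<Rightarrow> bool"
  where "flat G \<longleftrightarrow> (\<forall>x l i j k. riemann G l i j k x = 0)"

text \<open>\<open>Ric(Y, Z)\<close> is the trace of \<open>X \<mapsto> R(X, Y) Z\<close>, so that round spheres have
  positive Ricci curvature.\<close>

definition ricci :: "(real^'n::finite \<Rightarrow> real^'n^'n) \<Rightarrow> real^'n \<Rightarrow> real^'n^'n"
  where "ricci G x = (\<chi> j k. \<Sum>i\<in>UNIV. riemann G i i j k x)"

definition scalar_curvature :: "(real^'n::finite \<Rightarrow> real^'n^'n) \<Rightarrow> real^'n \<Rightarrow> real"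
  where "scalar_curvature G x =
    (\<Sum>i\<in>UNIV. \<Sum>j\<in>UNIV. matrix_inv (G x) $ i $ j * ricci G x $ i $ j)"

definition hessian ::
    "(real^'n::finite \<Rightarrow> real^'n^'n) \<Rightarrow> (real^'n \<Rightarrow> real) \<Rightarrow> real^'n \<Rightarrow> real^'n^'n"
  where "hessian G h x =
    (\<chi> i j. pd i (pd j h) x - (\<Sum>k\<in>UNIV. christoffel G k i j x * pd k h x))"

text \<open>The argument \<open>c\<close> is the constant usually written \<open>\<lambda>\<close>; the metric is a gradient
  \<open>\<rho>\<close>-Einstein soliton with potential \<open>h\<close> if this holds for some \<open>c\<close>, and a steady one
  if it holds for \<open>c = 0\<close>.\<close>

definition gradient_rho_einstein_soliton ::
    "real \<Rightarrow> real \<Rightarrow> (real^'n::finite \<Rightarrow> real^'n^'n) \<Rightarrow> (real^'n \<Rightarrow> real) \<Rightarrow> bool"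
  where "gradient_rho_einstein_soliton \<rho> c G h \<longleftrightarrow>
    CARD('n) \<ge> 3 \<and> \<rho> \<noteq> 0 \<and> semi_riemannian_metric G \<and> smooth h \<and>
    (\<forall>x. ricci G x + hessian G h x =
           (\<rho> * scalar_curvature G x) *\<^sub>R G x + c *\<^sub>R G x)"

definition steady_gradient_rho_einstein_soliton ::
    "real \<Rightarrow> (real^'n::finite \<Rightarrow> real^'n^'n) \<Rightarrow> (real^'n \<Rightarrow> real) \<Rightarrow> bool"
  where "steady_gradient_rho_einstein_soliton \<rho> G h \<longleftrightarrow> gradient_rho_einstein_soliton \<rho> 0 G h"

definition pseudo_euclidean :: "('n::finite \<Rightarrow> real) \<Rightarrow> real^'n^'n"
  where "pseudo_euclidean \<epsilon> = (\<chi> i j. if i = j then \<epsilon> i else 0)"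

definition quad_r :: "('n::finite \<Rightarrow> real) \<Rightarrow> real^'n \<Rightarrow> real"
  where "quad_r \<epsilon> x = (\<Sum>k\<in>UNIV. \<epsilon> k * (x $ k)\<^sup>2)"

text \<open>The profile \<open>\<phi>\<close> is arbitrary here; smoothness is imposed on the function on \<open>\<real>\<^sup>n\<close>.\<close>

definition depends_only_on_r :: "('n::finite \<Rightarrow> real) \<Rightarrow> (real^'n \<Rightarrow> real) \<Rightarrow> bool"
  where "depends_only_on_r \<epsilon> f \<longleftrightarrow> (\<exists>\<phi> :: real \<Rightarrow> real. \<forall>x. f x = \<phi> (quad_r \<epsilon> x))"

definition conformal_metric ::
    "('n::finite \<Rightarrow> real) \<Rightarrow> (real^'n \<Rightarrow> real) \<Rightarrow> real^'n \<Rightarrow> real^'n^'n"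
  where "conformal_metric \<epsilon> \<psi> x = (1 / (\<psi> x)\<^sup>2) *\<^sub>R pseudo_euclidean \<epsilon>"

end

theory Submission
  imports Defs
begin

text \<open>
  The scalar curvature of \<open>g / \<psi>\<^sup>2\<close> is \<open>(n - 1) (2 \<psi> \<Delta>\<psi> - n |\<nabla>\<psi>|\<^sup>2)\<close>. Along a coordinate
  axis, \<open>p t = \<psi> (t e\<^sub>i)\<close>, and the dependence on \<open>r\<close> alone turns each transverse second
  derivative into \<open>\<plusminus> p' / t\<close>, so vanishing scalar curvature becomes
  \<open>2 p (p'' + (n - 1) p' / t) = n p'\<^sup>2\<close> for \<open>t > 0\<close>, that is,
  \<open>t ^ (n - 1) p' |p| powr (- n / 2)\<close> is constant. It vanishes at \<open>t = 0\<close>, where \<open>\<psi>\<close> is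
  smooth, hence \<open>p\<close> is constant on every axis. Every value of \<open>r\<close> is attained on some
  axis, so \<open>\<psi>\<close> is constant and the metric is flat. Flatness in turn forces zero scalar
  curvature, hence a constant \<open>\<psi>\<close> (this is how smoothness of the metric is obtained), and
  \<open>h = 0\<close> is a potential.
\<close>

section \<open>Calculus of partial derivatives\<close>

lemma pd_eq: "(f has_derivative D) (at x) \<Longrightarrow> pd i f x = D (axis i 1)"
  unfolding pd_def by (simp add: frechet_derivative_at[symmetric])

lemma pd_has_derivative:
  "f differentiable (at x) \<Longrightarrow> \<exists>D. (f has_derivative D) (at x) \<and> (\<forall>i. pd i f x = D (axis i 1))"
  unfolding differentiable_def using pd_eq by blast

lemma pd_const [simp]: "pd i (\<lambda>x. c) = (\<lambda>x. 0)"
  by (rule ext) (rule pd_eq[OF has_derivative_const])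

lemma smooth_const: "smooth (\<lambda>x::real^'n::finite. c)"
proof -
  have "continuously_diff k (\<lambda>x::real^'n. c)" for k
    by (induction k arbitrary: c) auto
  then show ?thesis by (simp add: smooth_def)
qed

lemma smooth_imp_differentiable:
  assumes "smooth f"
  shows "f differentiable (at x)" "pd i f differentiable (at x)"
proof -
  have "continuously_diff 2 f" using assms by (simp add: smooth_def)
  then show "f differentiable (at x)" "pd i f differentiable (at x)"
    by (auto simp: numeral_2_eq_2)
qed

text \<open>Chain rule along a coordinate line. It reduces identities between partial derivatives to
  one-variable calculus, where uniqueness of the derivative can be used.\<close>

lemma pd_has_real_derivative_line:
  assumes "\<And>x. f differentiable (at x)"
  shows "((\<lambda>s. f (y + s *\<^sub>R axis k 1)) has_real_derivative pd k f (y + s *\<^sub>R axis k 1)) (at s)"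
proof -
  obtain D where D: "(f has_derivative D) (at (y + s *\<^sub>R axis k 1))"
    and p: "pd k f (y + s *\<^sub>R axis k 1) = D (axis k 1)"
    using pd_has_derivative[OF assms] by blast
  have "((\<lambda>s. y + s *\<^sub>R axis k 1) has_derivative (\<lambda>h. h *\<^sub>R axis k 1)) (at s)"
    by (auto intro!: derivative_eq_intros)
  from has_derivative_compose[OF this D]
  have "((\<lambda>s. f (y + s *\<^sub>R axis k 1)) has_derivative (\<lambda>h. D (h *\<^sub>R axis k 1))) (at s)" .
  moreover have "(\<lambda>h. D (h *\<^sub>R axis k 1)) = (*) (pd k f (y + s *\<^sub>R axis k 1))"
    using has_derivative_linear[OF D] by (auto simp: linear_scale p)
  ultimately show ?thesis by (simp add: has_field_derivative_def)
qed

text \<open>The three-term shape with constant coefficients is that of the Christoffel symbols of a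
  conformal metric, so this differentiates them directly.\<close>

lemma pd_linear_combination3:
  assumes "f differentiable (at x)" "g differentiable (at x)" "h differentiable (at x)"
  shows "pd i (\<lambda>y. a * f y + b * g y + c * h y) x = a * pd i f x + b * pd i g x + c * pd i h x"
proof -
  obtain F G H where *: "(f has_derivative F) (at x)" "(g has_derivative G) (at x)"
     "(h has_derivative H) (at x)"
    using assms unfolding differentiable_def by blast
  have "((\<lambda>y. a * f y + b * g y + c * h y) has_derivative (\<lambda>v. a * F v + b * G v + c * H v)) (at x)"
    by (intro derivative_intros *)
  from pd_eq[OF this] show ?thesis by (simp add: pd_eq[OF *(1)] pd_eq[OF *(2)] pd_eq[OF *(3)])
qed

lemma pd_inverse_square:
  fixes f :: "real^'n::finite \<Rightarrow> real"
  assumes "f differentiable (at x)" "f x \<noteq> 0"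
  shows "pd i (\<lambda>y. c / (f y)\<^sup>2) x = - 2 * c * pd i f x / (f x) ^ 3"
proof -
  obtain D where D: "(f has_derivative D) (at x)"
    using assms unfolding differentiable_def by blast
  have "((\<lambda>y. c / (f y)\<^sup>2) has_derivative (\<lambda>v. - 2 * c * D v / (f x) ^ 3)) (at x)"
    using assms(2)
    by (auto intro!: derivative_eq_intros D simp: field_simps power2_eq_square power3_eq_cube)
  from pd_eq[OF this] show ?thesis by (simp add: pd_eq[OF D])
qed

lemma pd_divide:
  fixes f g :: "real^'n::finite \<Rightarrow> real"
  assumes "f differentiable (at x)" "g differentiable (at x)" "g x \<noteq> 0"
  shows "pd i (\<lambda>y. f y / g y) x = pd i f x / g x - f x * pd i g x / (g x)\<^sup>2"
proof -
  obtain F G where *: "(f has_derivative F) (at x)" "(g has_derivative G) (at x)"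
    using assms unfolding differentiable_def by blast
  have "((\<lambda>y. f y / g y) has_derivative (\<lambda>v. F v / g x - f x * G v / (g x)\<^sup>2)) (at x)"
    using assms(3)
    by (auto intro!: derivative_eq_intros * simp: field_simps power2_eq_square)
  from pd_eq[OF this] show ?thesis by (simp add: pd_eq[OF *(1)] pd_eq[OF *(2)])
qed

section \<open>The conformal metric: inverse, Christoffel symbols and scalar curvature\<close>

lemma matrix_inv_unique:
  fixes A B :: "real^'n^'n"
  assumes "A ** B = mat 1" "B ** A = mat 1"
  shows "matrix_inv A = B"
proof -
  \<comment> \<open>\<open>matrix_inv\<close> is a Hilbert choice; the witness \<open>B\<close>
    shows that the chosen matrix really is an inverse.\<close>
  have "A ** matrix_inv A = mat 1"
    using assms unfolding matrix_inv_def by (metis (mono_tags, lifting) someI)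
  then have "B ** (A ** matrix_inv A) = B" by simp
  then show ?thesis by (simp add: matrix_mul_assoc assms(2))
qed

lemma conformal_metric_component:
  "conformal_metric \<epsilon> \<psi> x $ i $ j = (if i = j then \<epsilon> i else 0) / (\<psi> x)\<^sup>2"
  by (simp add: conformal_metric_def pseudo_euclidean_def)

lemma conformal_metric_inverse:
  assumes eps: "\<And>i. \<epsilon> i = 1 \<or> \<epsilon> i = -1" and nz: "\<psi> x \<noteq> 0"
  defines "H \<equiv> (\<psi> x)\<^sup>2 *\<^sub>R pseudo_euclidean \<epsilon>"
  shows "conformal_metric \<epsilon> \<psi> x ** H = mat 1" "H ** conformal_metric \<epsilon> \<psi> x = mat 1"
proof -
  have e: "\<epsilon> i * \<epsilon> i = 1" for i using eps[of i] by auto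
  have "(\<Sum>k\<in>UNIV. conformal_metric \<epsilon> \<psi> x $ i $ k * H $ k $ j) = (if i = j then 1 else 0)"
    and "(\<Sum>k\<in>UNIV. H $ i $ k * conformal_metric \<epsilon> \<psi> x $ k $ j) = (if i = j then 1 else 0)" for i j
  proof -
    have "conformal_metric \<epsilon> \<psi> x $ i $ k * H $ k $ j = (if k = i then if i = j then 1 else 0 else 0)"
      "H $ i $ k * conformal_metric \<epsilon> \<psi> x $ k $ j = (if k = i then if i = j then 1 else 0 else 0)" for k
      using nz e by (auto simp: H_def conformal_metric_component pseudo_euclidean_def)
    then show "(\<Sum>k\<in>UNIV. conformal_metric \<epsilon> \<psi> x $ i $ k * H $ k $ j) = (if i = j then 1 else 0)"
      "(\<Sum>k\<in>UNIV. H $ i $ k * conformal_metric \<epsilon> \<psi> x $ k $ j) = (if i = j then 1 else 0)"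
      by simp_all
  qed
  then show "conformal_metric \<epsilon> \<psi> x ** H = mat 1" "H ** conformal_metric \<epsilon> \<psi> x = mat 1"
    by (simp_all add: matrix_matrix_mult_def mat_def vec_eq_iff)
qed

lemma matrix_inv_conformal_metric:
  assumes "\<And>i. \<epsilon> i = 1 \<or> \<epsilon> i = -1" and "\<psi> x \<noteq> 0"
  shows "matrix_inv (conformal_metric \<epsilon> \<psi> x) $ i $ j = (\<psi> x)\<^sup>2 * (if i = j then \<epsilon> i else 0)"
proof -
  have "matrix_inv (conformal_metric \<epsilon> \<psi> x) = (\<psi> x)\<^sup>2 *\<^sub>R pseudo_euclidean \<epsilon>"
    using conformal_metric_inverse[of \<epsilon> \<psi> x, OF assms] by (rule matrix_inv_unique)
  then show ?thesis by (simp add: pseudo_euclidean_def)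
qed

text \<open>Only the logarithmic gradient of \<psi> survives, because differentiating the factor
  \<open>1 / \<psi>\<^sup>2\<close> and then multiplying by the inverse metric cancels all other
  powers of \<psi>. The signs and Kronecker deltas are kept as constant coefficients, ready for
  \<open>pd_linear_combination3\<close>.\<close>

lemma christoffel_conformal_metric:
  fixes \<psi> :: "real^'n::finite \<Rightarrow> real"
  assumes eps: "\<And>i. \<epsilon> i = 1 \<or> \<epsilon> i = -1" and nz: "\<And>x. \<psi> x \<noteq> 0"
    and diff: "\<And>x. \<psi> differentiable (at x)"
  shows "christoffel (conformal_metric \<epsilon> \<psi>) k i j = (\<lambda>x.
      (if j = k then -1 else 0) * (pd i \<psi> x / \<psi> x) + (if i = k then -1 else 0) * (pd j \<psi> x / \<psi> x)
      + (if i = j then \<epsilon> i * \<epsilon> k else 0) * (pd k \<psi> x / \<psi> x))"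
proof
  fix x
  have e: "\<epsilon> i * \<epsilon> i = 1" for i using eps[of i] by auto
  have p: "pd l (\<lambda>y. conformal_metric \<epsilon> \<psi> y $ i $ j) x =
      - 2 * (if i = j then \<epsilon> i else 0) * pd l \<psi> x / (\<psi> x) ^ 3" for l i j
    unfolding conformal_metric_component by (rule pd_inverse_square[OF diff nz])
  \<comment> \<open>The inverse metric is diagonal, so only the summand \<open>l = k\<close>
    remains.\<close>
  have "christoffel (conformal_metric \<epsilon> \<psi>) k i j x =
    1 / 2 * ((\<psi> x)\<^sup>2 * \<epsilon> k * (pd i (\<lambda>y. conformal_metric \<epsilon> \<psi> y $ j $ k) x
     + pd j (\<lambda>y. conformal_metric \<epsilon> \<psi> y $ i $ k) x - pd k (\<lambda>y. conformal_metric \<epsilon> \<psi> y $ i $ j) x))"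
    unfolding christoffel_def matrix_inv_conformal_metric[OF eps nz]
    by (subst sum.remove[of _ k]) auto
  also have "\<dots> = (if j = k then -1 else 0) * (pd i \<psi> x / \<psi> x) + (if i = k then -1 else 0) * (pd j \<psi> x / \<psi> x)
      + (if i = j then \<epsilon> i * \<epsilon> k else 0) * (pd k \<psi> x / \<psi> x)"
    unfolding p using nz[of x] e
    by (auto simp: field_simps power2_eq_square power3_eq_cube)
  finally show "christoffel (conformal_metric \<epsilon> \<psi>) k i j x = \<dots>" .
qed

text \<open>
  The algebra behind the scalar curvature: \<open>a\<close> stands for the logarithmic gradient of \<open>\<psi>\<close>,
  \<open>b l i\<close> for \<open>\<partial>\<^sub>l a\<^sub>i\<close>, \<open>C\<close> for the Christoffel symbols and \<open>D l\<close> for their \<open>l\<close>-th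
  partial derivatives.
\<close>

lemma curvature_contraction:
  fixes \<epsilon> a :: "'n::finite \<Rightarrow> real" and b :: "'n \<Rightarrow> 'n \<Rightarrow> real"
  assumes eps: "\<And>i. \<epsilon> i = 1 \<or> \<epsilon> i = -1"
  defines "C \<equiv> \<lambda>k i j. (if j = k then -1 else 0) * a i + (if i = k then -1 else 0) * a j
      + (if i = j then \<epsilon> i * \<epsilon> k else 0) * a k"
    and "D \<equiv> \<lambda>l k i j. (if j = k then -1 else 0) * b l i + (if i = k then -1 else 0) * b l j
      + (if i = j then \<epsilon> i * \<epsilon> k else 0) * b l k"
    and "N \<equiv> real CARD('n)"
  shows "(\<Sum>j\<in>UNIV. \<epsilon> j * (\<Sum>i\<in>UNIV. D i i j j - D j i i j
            + (\<Sum>m\<in>UNIV. C i i m * C m j j - C i j m * C m i j))) =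
         (N - 1) * (2 * (\<Sum>i\<in>UNIV. \<epsilon> i * b i i) - (N - 2) * (\<Sum>i\<in>UNIV. \<epsilon> i * (a i)\<^sup>2))"
proof -
  have e: "\<epsilon> i * \<epsilon> i = 1" "\<epsilon> i * (\<epsilon> i * z) = z" for i z using eps[of i] by auto
  define A B where "A = (\<Sum>i\<in>UNIV. \<epsilon> i * b i i)" and "B = (\<Sum>i\<in>UNIV. \<epsilon> i * (a i)\<^sup>2)"
  have d1: "(\<Sum>i\<in>UNIV. D i i j j) = -2 * b j j + \<epsilon> j * A" for j
  proof -
    have "D i i j j = (if i = j then -2 * b j j else 0) + \<epsilon> j * (\<epsilon> i * b i i)" for i
      by (auto simp: D_def)
    then show ?thesis by (simp add: sum.distrib A_def flip: sum_distrib_left)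
  qed
  have d2: "(\<Sum>i\<in>UNIV. D j i i j) = - N * b j j" for j
  proof -
    have "D j i i j = - b j j" for i
      by (auto simp: D_def e)
    then show ?thesis by (simp add: N_def)
  qed
  \<comment> \<open>The contracted symbol is the logarithmic derivative of the volume density
    \<open>\<bar>\<psi>\<bar> powr (- N)\<close>.\<close>
  have c1: "(\<Sum>i\<in>UNIV. C i i m) = - N * a m" for m
  proof -
    have "C i i m = - a m" for i
      by (auto simp: C_def e)
    then show ?thesis by (simp add: N_def)
  qed
  have q1: "(\<Sum>i\<in>UNIV. \<Sum>m\<in>UNIV. C i i m * C m j j) = 2 * N * (a j)\<^sup>2 - N * \<epsilon> j * B" for j
  proof -
    have "(\<Sum>i\<in>UNIV. \<Sum>m\<in>UNIV. C i i m * C m j j) = (\<Sum>m\<in>UNIV. - N * a m * C m j j)"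
      by (subst sum.swap) (simp add: c1 flip: sum_distrib_right)
    also have "\<dots> = - N * (\<Sum>m\<in>UNIV. a m * C m j j)"
      by (simp add: sum_distrib_left mult.assoc)
    also have "(\<Sum>m\<in>UNIV. a m * C m j j) = - 2 * (a j)\<^sup>2 + \<epsilon> j * B"
    proof -
      have "a m * C m j j = (if m = j then - 2 * (a j)\<^sup>2 else 0) + \<epsilon> j * (\<epsilon> m * (a m)\<^sup>2)" for m
        by (auto simp: C_def power2_eq_square algebra_simps)
      then show ?thesis by (simp add: sum.distrib B_def flip: sum_distrib_left)
    qed
    finally show ?thesis by (simp add: algebra_simps)
  qed
  have q2: "(\<Sum>i\<in>UNIV. \<Sum>m\<in>UNIV. C i j m * C m i j) = (N + 2) * (a j)\<^sup>2 - 2 * \<epsilon> j * B" for j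
  proof -
    \<comment> \<open>The product lives on the diagonals \<open>m = i\<close>, \<open>m = j\<close>
      and \<open>i = j\<close>. Splitting it this way lets each piece be summed over
      \<open>m\<close> separately.\<close>
    have "C i j m * C m i j = (if m = i then (a j)\<^sup>2 else 0)
        + (if m = j then (if i = j then 2 * (a j)\<^sup>2 else 0) - \<epsilon> i * \<epsilon> j * (a i)\<^sup>2 else 0)
        + (if i = j then - \<epsilon> j * (\<epsilon> m * (a m)\<^sup>2) else 0)" for i m
      by (auto simp: C_def e power2_eq_square algebra_simps)
    then have inner: "(\<Sum>m\<in>UNIV. C i j m * C m i j) = (a j)\<^sup>2 - \<epsilon> j * (\<epsilon> i * (a i)\<^sup>2)
        + (if i = j then 2 * (a j)\<^sup>2 - \<epsilon> j * B else 0)" for i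
      by (simp add: sum.distrib B_def sum_negf flip: sum_distrib_left)
    show ?thesis unfolding inner
      by (simp add: sum.distrib sum_subtractf B_def[symmetric] N_def flip: sum_distrib_left)
        (simp add: algebra_simps)
  qed
  \<comment> \<open>These are the diagonal Ricci components. The inverse metric is diagonal, so the
    scalar curvature needs no others.\<close>
  have ricci: "(\<Sum>i\<in>UNIV. D i i j j - D j i i j + (\<Sum>m\<in>UNIV. C i i m * C m j j - C i j m * C m i j)) =
     (N - 2) * b j j + \<epsilon> j * A + (N - 2) * (a j)\<^sup>2 - (N - 2) * \<epsilon> j * B" for j
    by (simp add: sum.distrib sum_subtractf d1 d2 q1 q2) (simp add: algebra_simps)
  have "(\<Sum>j\<in>UNIV. \<epsilon> j * (\<Sum>i\<in>UNIV. D i i j j - D j i i j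
            + (\<Sum>m\<in>UNIV. C i i m * C m j j - C i j m * C m i j))) =
     (\<Sum>j\<in>UNIV. (N - 2) * (\<epsilon> j * b j j) + A + (N - 2) * (\<epsilon> j * (a j)\<^sup>2) - (N - 2) * B)"
    by (simp only: ricci) (simp add: e algebra_simps)
  also have "\<dots> = (N - 2) * A + N * A + (N - 2) * B - N * (N - 2) * B"
    unfolding A_def B_def N_def by (simp add: sum.distrib sum_subtractf flip: sum_distrib_left)
  finally show ?thesis by (simp add: A_def B_def algebra_simps)
qed


text \<open>This is \<open>(n - 1) (2 \<psi> \<Delta>\<psi> - n |\<nabla>\<psi>|\<^sup>2)\<close>
  written in logarithmic derivatives, the form in which the contraction delivers it: the first
  bracket is the derivative of \<open>pd i \<psi> / \<psi>\<close>.\<close>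

lemma scalar_curvature_conformal_metric:
  fixes \<psi> :: "real^'n::finite \<Rightarrow> real"
  assumes eps: "\<And>i. \<epsilon> i = 1 \<or> \<epsilon> i = -1" and nz: "\<And>x. \<psi> x \<noteq> 0"
    and smooth: "smooth \<psi>"
  shows "scalar_curvature (conformal_metric \<epsilon> \<psi>) x = (\<psi> x)\<^sup>2 * ((real CARD('n) - 1) *
      (2 * (\<Sum>i\<in>UNIV. \<epsilon> i * (pd i (pd i \<psi>) x / \<psi> x - (pd i \<psi> x / \<psi> x)\<^sup>2))
       - (real CARD('n) - 2) * (\<Sum>i\<in>UNIV. \<epsilon> i * (pd i \<psi> x / \<psi> x)\<^sup>2)))"
proof -
  let ?G = "conformal_metric \<epsilon> \<psi>"
  note diff = smooth_imp_differentiable[OF smooth]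
  define a where "a = (\<lambda>i. pd i \<psi> x / \<psi> x)"
  define b where "b = (\<lambda>l i. pd l (\<lambda>y. pd i \<psi> y / \<psi> y) x)"
  have "(\<lambda>y. pd i \<psi> y / \<psi> y) differentiable (at x)" for i
    by (intro differentiable_divide diff nz)
  note pd_christoffel = pd_linear_combination3[OF this this this]
  note chr = christoffel_conformal_metric[OF eps nz diff(1)]
  have "scalar_curvature ?G x = (\<Sum>j\<in>UNIV. \<Sum>i\<in>UNIV. if i = j then (\<psi> x)\<^sup>2 * \<epsilon> j * ricci ?G x $ j $ j else 0)"
    unfolding scalar_curvature_def matrix_inv_conformal_metric[OF eps nz]
    by (intro sum.cong refl) auto
  also have "\<dots> = (\<psi> x)\<^sup>2 * (\<Sum>j\<in>UNIV. \<epsilon> j * ricci ?G x $ j $ j)"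
    by (simp add: sum_distrib_left mult.assoc)
  also have "(\<Sum>j\<in>UNIV. \<epsilon> j * ricci ?G x $ j $ j) = (real CARD('n) - 1) *
     (2 * (\<Sum>i\<in>UNIV. \<epsilon> i * b i i) - (real CARD('n) - 2) * (\<Sum>i\<in>UNIV. \<epsilon> i * (a i)\<^sup>2))"
    \<comment> \<open>Once the Christoffel formula is inserted and differentiated, the derivative
      and quadratic parts of the curvature are literally the \<open>D\<close> and \<open>C\<close>
      of the contraction.\<close>
    by (rule trans[OF _ curvature_contraction[OF eps, where a = a and b = b]])
      (simp only: ricci_def riemann_def chr pd_christoffel a_def b_def vec_lambda_beta)
  also have "(\<lambda>i. b i i) = (\<lambda>i. pd i (pd i \<psi>) x / \<psi> x - (pd i \<psi> x / \<psi> x)\<^sup>2)"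
    unfolding b_def using pd_divide[OF diff(2) diff(1) nz]
    by (simp add: power2_eq_square)
  finally show ?thesis unfolding a_def .
qed

section \<open>Functions of r near a coordinate axis\<close>

lemma quad_r_axis_plus:
  fixes i k :: "'n::finite"
  assumes "i \<noteq> k"
  shows "quad_r \<epsilon> (t *\<^sub>R axis i 1 + s *\<^sub>R axis k 1) = \<epsilon> i * t\<^sup>2 + \<epsilon> k * s\<^sup>2"
proof -
  have "\<epsilon> l * ((t *\<^sub>R axis i 1 + s *\<^sub>R axis k 1 :: real^'n) $ l)\<^sup>2 =
     (if l = i then \<epsilon> i * t\<^sup>2 else 0) + (if l = k then \<epsilon> k * s\<^sup>2 else 0)" for l
    using assms by (auto simp: axis_def)
  then show ?thesis by (simp add: quad_r_def sum.distrib)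
qed

lemma quad_r_axis: "quad_r \<epsilon> (t *\<^sub>R axis (i::'n::finite) 1) = \<epsilon> i * t\<^sup>2"
proof -
  have "\<epsilon> l * ((t *\<^sub>R axis i 1 :: real^'n) $ l)\<^sup>2 = (if l = i then \<epsilon> i * t\<^sup>2 else 0)" for l
    by (auto simp: axis_def)
  then show ?thesis by (simp add: quad_r_def)
qed

text \<open>Moving from \<open>t e\<^sub>i\<close> by \<open>s e\<^sub>k\<close> changes r exactly
  as moving along axis \<open>i\<close> to
  \<open>m s = sqrt (t\<^sup>2 + \<sigma> s\<^sup>2)\<close>. Hence \<psi> on the transverse line is
  \<open>p (m s)\<close>, and both claims follow by differentiating this at \<open>s = 0\<close>.
  The profile of \<psi> as a function of r is never differentiated, as nothing is known about its
  regularity.\<close>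

lemma transverse_derivatives_on_axis:
  fixes \<psi> :: "real^'n::finite \<Rightarrow> real"
  assumes eps: "\<And>i. \<epsilon> i = 1 \<or> \<epsilon> i = -1"
    and smooth: "smooth \<psi>" and dep: "depends_only_on_r \<epsilon> \<psi>"
    and t: "t > 0" and "i \<noteq> k"
  shows "pd k \<psi> (t *\<^sub>R axis i 1) = 0"
    and "pd k (pd k \<psi>) (t *\<^sub>R axis i 1) = \<epsilon> i * \<epsilon> k * pd i \<psi> (t *\<^sub>R axis i 1) / t"
proof -
  note diff = smooth_imp_differentiable[OF smooth]
  define \<sigma> where "\<sigma> = \<epsilon> i * \<epsilon> k"
  have \<sigma>: "\<sigma> = 1 \<or> \<sigma> = -1" using eps[of i] eps[of k] by (auto simp: \<sigma>_def)
  define m where "m = (\<lambda>s. sqrt (t\<^sup>2 + \<sigma> * s\<^sup>2))"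
  define p where "p = (\<lambda>s. \<psi> (s *\<^sub>R axis i 1))"
  define p' where "p' = (\<lambda>s. pd i \<psi> (s *\<^sub>R axis i 1))"
  have p: "(p has_real_derivative p' s) (at s)" for s
    using pd_has_real_derivative_line[OF diff(1), where y = 0] by (simp add: p_def p'_def)
  have p': "(p' has_real_derivative pd i (pd i \<psi>) (s *\<^sub>R axis i 1)) (at s)" for s
    using pd_has_real_derivative_line[OF diff(2), where y = 0] by (simp add: p'_def)
  \<comment> \<open>For \<open>\<sigma> = -1\<close> the radicand stays positive only while
    \<open>\<bar>s\<bar> < t\<close>.\<close>
  have pos: "t\<^sup>2 + \<sigma> * s\<^sup>2 > 0" if "s \<in> {-t<..<t}" for s
  proof -
    have "\<bar>s\<bar>\<^sup>2 < t\<^sup>2" using that t by (intro power_strict_mono) auto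
    then have "s\<^sup>2 < t\<^sup>2" by simp
    moreover have "0 < t\<^sup>2" using t by simp
    ultimately show ?thesis using \<sigma> by (auto intro: add_pos_nonneg)
  qed
  have m: "(m has_real_derivative \<sigma> * s / m s) (at s)" if "s \<in> {-t<..<t}" for s
    unfolding m_def using pos[OF that]
    by (auto intro!: derivative_eq_intros simp: field_simps)
  have eq: "\<psi> (t *\<^sub>R axis i 1 + s *\<^sub>R axis k 1) = p (m s)" if "s \<in> {-t<..<t}" for s
  proof -
    have "\<epsilon> i * (m s)\<^sup>2 = \<epsilon> i * t\<^sup>2 + \<epsilon> k * s\<^sup>2"
      using pos[OF that] eps[of i] by (auto simp: m_def \<sigma>_def algebra_simps)
    then show ?thesis using dep
      by (auto simp: depends_only_on_r_def p_def quad_r_axis quad_r_axis_plus[OF \<open>i \<noteq> k\<close>])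
  qed
  \<comment> \<open>The formula is proved on a whole interval, not just at \<open>s = 0\<close>,
    because it is differentiated once more.\<close>
  have first: "pd k \<psi> (t *\<^sub>R axis i 1 + s *\<^sub>R axis k 1) = p' (m s) * (\<sigma> * s / m s)" if "s \<in> {-t<..<t}" for s
  proof (rule DERIV_unique)
    show "((\<lambda>s. \<psi> (t *\<^sub>R axis i 1 + s *\<^sub>R axis k 1)) has_real_derivative
        pd k \<psi> (t *\<^sub>R axis i 1 + s *\<^sub>R axis k 1)) (at s)"
      by (rule pd_has_real_derivative_line[OF diff(1)])
    have "((\<lambda>s. p (m s)) has_real_derivative p' (m s) * (\<sigma> * s / m s)) (at s)"
      by (rule DERIV_chain2[OF p m[OF that]])
    then show "((\<lambda>s. \<psi> (t *\<^sub>R axis i 1 + s *\<^sub>R axis k 1)) has_real_derivative p' (m s) * (\<sigma> * s / m s)) (at s)"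
      by (rule has_field_derivative_transform_within_open[where S = "{-t<..<t}"])
        (use that eq in auto)
  qed
  have m0: "m 0 = t" using t by (simp add: m_def)
  show "pd k \<psi> (t *\<^sub>R axis i 1) = 0"
    using first[of 0] t by simp
  \<comment> \<open>The derivative of \<open>m\<close> vanishes at 0, so the second derivative of
    \<open>p\<close> drops out of the product rule.\<close>
  have "((\<lambda>s. p' (m s) * (\<sigma> * s / m s)) has_real_derivative \<sigma> * p' t / t) (at 0)"
  proof -
    have m0': "(m has_real_derivative 0) (at 0)" using m[of 0] t by simp
    have "((\<lambda>s. \<sigma> * s / m s) has_real_derivative \<sigma> / t) (at 0)"
      by (rule derivative_eq_intros m0' refl)+ (use t m0 in auto)
    from DERIV_mult[OF DERIV_chain2[OF p' m0'] this] show ?thesis by (simp add: m0 mult.commute)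
  qed
  then have "((\<lambda>s. pd k \<psi> (t *\<^sub>R axis i 1 + s *\<^sub>R axis k 1)) has_real_derivative \<sigma> * p' t / t) (at 0)"
    by (rule has_field_derivative_transform_within_open[where S = "{-t<..<t}"])
      (use t first in auto)
  from DERIV_unique[OF pd_has_real_derivative_line[OF diff(2)] this]
  show "pd k (pd k \<psi>) (t *\<^sub>R axis i 1) = \<epsilon> i * \<epsilon> k * pd i \<psi> (t *\<^sub>R axis i 1) / t"
    by (simp add: \<sigma>_def p'_def)
qed

section \<open>The radial equation and constancy of the conformal factor\<close>

lemma radial_scalar_flat_ode_constant:
  fixes p p' p'' :: "real \<Rightarrow> real"
  assumes p: "\<And>t. (p has_real_derivative p' t) (at t)"
    and p': "\<And>t. (p' has_real_derivative p'' t) (at t)"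
    and nz: "\<And>t. p t \<noteq> 0" and n: "n \<ge> 2"
    and ode: "\<And>t. t > 0 \<Longrightarrow> 2 * (p'' t / p t - (p' t / p t)\<^sup>2 + (real n - 1) * (p' t / (t * p t)))
        = (real n - 2) * (p' t / p t)\<^sup>2"
    and t: "t \<ge> 0"
  shows "p t = p 0"
proof -
  \<comment> \<open>Squaring inside the logarithm covers both signs of \<open>p\<close>; the factor
    \<open>exp (- (n / 4) * l t)\<close> is \<open>\<bar>p t\<bar> powr (- n / 2)\<close>.\<close>
  define l where "l = (\<lambda>t. ln ((p t)\<^sup>2))"
  define W where "W = (\<lambda>t. t ^ (n - 1) * p' t * exp (- (real n / 4) * l t))"
  define W' where "W' = (\<lambda>t. (real (n - 1) * t ^ (n - 2) * p' t + t ^ (n - 1) * (p'' t - real n / 2 * (p' t)\<^sup>2 / p t))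
      * exp (- (real n / 4) * l t))"
  have W: "(W has_real_derivative W' t) (at t)" for t
  proof -
    have sq: "((\<lambda>t. (p t)\<^sup>2) has_real_derivative 2 * p t * p' t) (at t)"
      by (auto intro!: derivative_eq_intros p)
    have "(l has_real_derivative 1 / (p t)\<^sup>2 * (2 * p t * p' t)) (at t)"
      unfolding l_def by (rule DERIV_chain2[OF DERIV_ln_divide sq]) (use nz in simp)
    then have l: "(l has_real_derivative 2 * p' t / p t) (at t)"
      using nz[of t] by (simp add: power2_eq_square)
    have "n - 1 - 1 = n - 2" using n by simp
    then show ?thesis
      unfolding W_def W'_def
      by (auto intro!: derivative_eq_intros p' l simp: algebra_simps power2_eq_square)
  qed
  have W'0: "W' t = 0" if "t > 0" for t
  proof -
    have "n - 1 = Suc (n - 2)" using n by simp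
    then have pow: "t ^ (n - 1) = t * t ^ (n - 2)" by simp
    \<comment> \<open>The bracket of \<open>W'\<close>, with \<open>t ^ (n - 2)\<close> taken out,
      is \<open>p t * t / 2\<close> times the difference of the two sides of
      \<open>ode\<close>.\<close>
    have "(real n - 1) * p' t + t * (p'' t - real n / 2 * (p' t)\<^sup>2 / p t) =
        p t * t / 2 * (2 * (p'' t / p t - (p' t / p t)\<^sup>2 + (real n - 1) * (p' t / (t * p t)))
          - (real n - 2) * (p' t / p t)\<^sup>2)"
      using nz[of t] that by (simp add: field_simps power2_eq_square)
    then have zero: "(real n - 1) * p' t + t * (p'' t - real n / 2 * (p' t)\<^sup>2 / p t) = 0"
      by (simp only: ode[OF that] diff_self mult_zero_right)
    have "real (n - 1) = real n - 1" using n by simp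
    then have "real (n - 1) * t ^ (n - 2) * p' t + t ^ (n - 1) * (p'' t - real n / 2 * (p' t)\<^sup>2 / p t)
       = t ^ (n - 2) * ((real n - 1) * p' t + t * (p'' t - real n / 2 * (p' t)\<^sup>2 / p t))"
      unfolding pow by (simp add: distrib_left)
    also have "\<dots> = 0" by (simp only: zero mult_zero_right)
    finally show ?thesis by (simp add: W'_def)
  qed
  \<comment> \<open>The derivative has to vanish only for positive arguments; continuity carries the
    constant value to 0. This serves for \<open>W\<close> and then for \<open>p\<close>.\<close>
  have const: "f s = f 0"
    if "s > 0" and f: "\<And>t. (f has_real_derivative f' t) (at t)" and "\<And>t. t > 0 \<Longrightarrow> f' t = 0"
    for f f' :: "real \<Rightarrow> real" and s
  proof (rule DERIV_isconst2[OF \<open>s > 0\<close>])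
    show "continuous_on {0..s} f"
      by (rule DERIV_continuous_on, rule has_field_derivative_at_within, rule f)
    show "(f has_real_derivative 0) (at x)" if "0 < x" "x < s" for x
      using f[of x] \<open>\<And>t. t > 0 \<Longrightarrow> f' t = 0\<close>[OF that(1)] by simp
  qed (use \<open>s > 0\<close> in auto)
  have p'0: "p' t = 0" if "t > 0" for t
  proof -
    have "W t = W 0" using that W W'0 by (rule const)
    \<comment> \<open>The factor \<open>t ^ (n - 1)\<close> vanishes at 0 because
      \<open>n \<ge> 2\<close>.\<close>
    moreover have "W 0 = 0" using n by (simp add: W_def)
    ultimately have "W t = 0" by simp
    then show ?thesis using that by (simp add: W_def)
  qed
  show ?thesis
  proof (cases "t = 0")
    case False
    then have "t > 0" using t by simp
    then show ?thesis using p p'0 by (rule const)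
  qed simp
qed

lemma scalar_flat_imp_constant_conformal_factor:
  fixes \<psi> :: "real^'n::finite \<Rightarrow> real"
  assumes n: "CARD('n) \<ge> 2"
    and eps: "\<And>i. \<epsilon> i = 1 \<or> \<epsilon> i = -1"
    and smooth: "smooth \<psi>" and dep: "depends_only_on_r \<epsilon> \<psi>"
    and nz: "\<And>x. \<psi> x \<noteq> 0"
    and K: "\<And>x. scalar_curvature (conformal_metric \<epsilon> \<psi>) x = 0"
  shows "\<psi> x = \<psi> 0"
proof -
  note diff = smooth_imp_differentiable[OF smooth]
  have axis_const: "\<psi> (t *\<^sub>R axis i 1) = \<psi> 0" if "t \<ge> 0" for i t
  proof -
    define p where "p = (\<lambda>s. \<psi> (s *\<^sub>R axis i 1))"
    define p' where "p' = (\<lambda>s. pd i \<psi> (s *\<^sub>R axis i 1))"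
    define p'' where "p'' = (\<lambda>s. pd i (pd i \<psi>) (s *\<^sub>R axis i 1))"
    have "p t = p 0"
    proof (rule radial_scalar_flat_ode_constant[OF _ _ _ n _ that])
      show "(p has_real_derivative p' s) (at s)" for s
        using pd_has_real_derivative_line[OF diff(1), where y = 0] by (simp add: p_def p'_def)
      show "(p' has_real_derivative p'' s) (at s)" for s
        using pd_has_real_derivative_line[OF diff(2), where y = 0] by (simp add: p'_def p''_def)
      show "p s \<noteq> 0" for s by (simp add: p_def nz)
      fix s :: real assume s: "s > 0"
      let ?x = "s *\<^sub>R axis i 1 :: real^'n"
      \<comment> \<open>In a transverse direction the two factors \<open>\<epsilon> k\<close>
        cancel, leaving the same term for every \<open>k\<close>. Giving that term to
        \<open>k = i\<close> as well, with a correction, makes the sum \<open>n\<close> equal terms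
        plus one.\<close>
      have A: "\<epsilon> k * (pd k (pd k \<psi>) ?x / \<psi> ?x - (pd k \<psi> ?x / \<psi> ?x)\<^sup>2) =
          \<epsilon> i * (p' s / (s * p s)) + (if k = i then \<epsilon> i * (p'' s / p s - (p' s / p s)\<^sup>2 - p' s / (s * p s)) else 0)" for k
      proof (cases "k = i")
        case True then show ?thesis by (simp add: p_def p'_def p''_def algebra_simps)
      next
        case False
        then show ?thesis
          using transverse_derivatives_on_axis[OF eps smooth dep s, of i k] eps[of k]
          by (auto simp: p_def p'_def)
      qed
      have B: "\<epsilon> k * (pd k \<psi> ?x / \<psi> ?x)\<^sup>2 = (if k = i then \<epsilon> i * (p' s / p s)\<^sup>2 else 0)" for k
        using transverse_derivatives_on_axis(1)[OF eps smooth dep s, of i k]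
        by (auto simp: p_def p'_def)
      \<comment> \<open>The nonzero factors \<open>(\<psi> ?x)\<^sup>2\<close> and
        \<open>n - 1\<close> are cancelled from the vanishing scalar curvature.\<close>
      have "2 * (\<Sum>k\<in>UNIV. \<epsilon> k * (pd k (pd k \<psi>) ?x / \<psi> ?x - (pd k \<psi> ?x / \<psi> ?x)\<^sup>2))
          = (real CARD('n) - 2) * (\<Sum>k\<in>UNIV. \<epsilon> k * (pd k \<psi> ?x / \<psi> ?x)\<^sup>2)"
        using K[of ?x] nz[of ?x] n
        unfolding scalar_curvature_conformal_metric[OF eps nz smooth] by simp
      then have "2 * (real CARD('n) * (\<epsilon> i * (p' s / (s * p s)))
            + \<epsilon> i * (p'' s / p s - (p' s / p s)\<^sup>2 - p' s / (s * p s)))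
          = (real CARD('n) - 2) * (\<epsilon> i * (p' s / p s)\<^sup>2)"
        unfolding A B by (simp add: sum.distrib)
      moreover have "e * (2 * (X + (N - 1) * Y)) = 2 * (N * (e * Y) + e * (X - Y))" for e N X Y :: real
        by (simp add: algebra_simps)
      ultimately have "\<epsilon> i * (2 * (p'' s / p s - (p' s / p s)\<^sup>2 + (real CARD('n) - 1) * (p' s / (s * p s))))
          = \<epsilon> i * ((real CARD('n) - 2) * (p' s / p s)\<^sup>2)"
        by (simp only: mult.left_commute)
      moreover have "\<epsilon> i \<noteq> 0" using eps[of i] by auto
      ultimately show "2 * (p'' s / p s - (p' s / p s)\<^sup>2 + (real CARD('n) - 1) * (p' s / (s * p s)))
        = (real CARD('n) - 2) * (p' s / p s)\<^sup>2"
        using mult_left_cancel by blast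
    qed
    then show ?thesis by (simp add: p_def)
  qed
  \<comment> \<open>Some axis must carry the sign of r; the point at distance
    \<open>sqrt \<bar>r\<bar>\<close> on it then has the same r as \<open>x\<close>.\<close>
  have "\<exists>i. quad_r \<epsilon> x = \<epsilon> i * (sqrt \<bar>quad_r \<epsilon> x\<bar>)\<^sup>2"
  proof (rule ccontr)
    assume no: "\<not> ?thesis"
    \<comment> \<open>If r had the sign opposite to every \<open>\<epsilon> i\<close>, expanding one
      factor of \<open>r * r\<close> would give a sum of nonpositive terms, so \<open>r = 0\<close>,
      against the strict inequality.\<close>
    have False if "\<And>i. \<epsilon> i * quad_r \<epsilon> x < 0"
    proof -
      have "quad_r \<epsilon> x * quad_r \<epsilon> x = (\<Sum>k\<in>UNIV. \<epsilon> k * quad_r \<epsilon> x * (x $ k)\<^sup>2)"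
        by (subst (2) quad_r_def) (simp add: sum_distrib_left algebra_simps)
      also have "\<dots> \<le> 0"
        by (rule sum_nonpos, rule mult_nonpos_nonneg) (use that less_imp_le in auto)
      finally have "quad_r \<epsilon> x = 0" by (auto simp: mult_le_0_iff)
      then show False using that by simp
    qed
    then obtain i where "\<epsilon> i * quad_r \<epsilon> x \<ge> 0" by (meson not_le)
    then have "quad_r \<epsilon> x = \<epsilon> i * (sqrt \<bar>quad_r \<epsilon> x\<bar>)\<^sup>2"
      using eps[of i] by auto
    then show False using no by blast
  qed
  then obtain i where "quad_r \<epsilon> x = quad_r \<epsilon> (sqrt \<bar>quad_r \<epsilon> x\<bar> *\<^sub>R axis i 1)"
    by (auto simp: quad_r_axis)
  then have "\<psi> x = \<psi> (sqrt \<bar>quad_r \<epsilon> x\<bar> *\<^sub>R axis i 1)"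
    using dep by (auto simp: depends_only_on_r_def)
  then show ?thesis using axis_const by simp
qed

section \<open>Flatness and the equivalence\<close>

lemma flat_imp_ricci_zero: "flat G \<Longrightarrow> ricci G x = 0"
  by (simp add: flat_def ricci_def vec_eq_iff)

lemma flat_imp_scalar_curvature_zero: "flat G \<Longrightarrow> scalar_curvature G x = 0"
  by (simp add: scalar_curvature_def flat_imp_ricci_zero)

lemma flat_constant_metric: "flat (\<lambda>x. A)"
proof -
  have "christoffel (\<lambda>x. A) k i j = (\<lambda>x. 0)" for k i j
    by (rule ext) (simp add: christoffel_def)
  then show ?thesis by (simp add: flat_def riemann_def)
qed

theorem corollary1p8:
  fixes \<epsilon> :: "'n::finite \<Rightarrow> real"
    and \<rho> :: real
    and \<psi> :: "real^'n \<Rightarrow> real"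
  assumes "CARD('n) \<ge> 3"
    and "\<And>i. \<epsilon> i = 1 \<or> \<epsilon> i = -1"
    and "\<rho> \<noteq> 0"
    and "smooth \<psi>"
    and "depends_only_on_r \<epsilon> \<psi>"
    and "\<And>x. \<psi> x \<noteq> 0"
  shows "(\<exists>h. depends_only_on_r \<epsilon> h \<and>
              steady_gradient_rho_einstein_soliton \<rho> (conformal_metric \<epsilon> \<psi>) h \<and>
              (\<forall>x. scalar_curvature (conformal_metric \<epsilon> \<psi>) x = 0))
         \<longleftrightarrow> flat (conformal_metric \<epsilon> \<psi>)"
proof -
  let ?G = "conformal_metric \<epsilon> \<psi>"
  have const: "?G = (\<lambda>x. ?G 0)" if "\<And>x. scalar_curvature ?G x = 0"
  proof
    fix x
    have "CARD('n) \<ge> 2" using assms(1) by simp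
    from scalar_flat_imp_constant_conformal_factor[OF this assms(2,4,5,6) that]
    have "\<psi> x = \<psi> 0" .
    then show "?G x = ?G 0" by (simp add: conformal_metric_def)
  qed
  show ?thesis
  proof
    assume "\<exists>h. depends_only_on_r \<epsilon> h \<and> steady_gradient_rho_einstein_soliton \<rho> ?G h \<and>
              (\<forall>x. scalar_curvature ?G x = 0)"
    then have "?G = (\<lambda>x. ?G 0)" using const by blast
    then show "flat ?G" using flat_constant_metric by metis
  next
    assume flat: "flat ?G"
    note K = flat_imp_scalar_curvature_zero[OF flat]
    have "smooth (\<lambda>x. ?G x $ i $ j)" for i j
      by (subst const[OF K]) (rule smooth_const)
    moreover have "transpose (?G x) = ?G x" for x
      by (simp add: vec_eq_iff transpose_def conformal_metric_component)
    moreover have "invertible (?G x)" for x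
      using conformal_metric_inverse[of \<epsilon> \<psi> x, OF assms(2,6)] unfolding invertible_def by blast
    ultimately have "semi_riemannian_metric ?G" by (simp add: semi_riemannian_metric_def)
    moreover have "hessian ?G (\<lambda>x. 0) x = 0" for x
      by (simp add: hessian_def vec_eq_iff)
    \<comment> \<open>Every term of the soliton equation vanishes: Ricci and scalar curvature by
      flatness, the Hessian because the potential is zero.\<close>
    ultimately have "steady_gradient_rho_einstein_soliton \<rho> ?G (\<lambda>x. 0)"
      using assms(1,3) K flat_imp_ricci_zero[OF flat] smooth_const
      by (simp add: steady_gradient_rho_einstein_soliton_def gradient_rho_einstein_soliton_def)
    moreover have "depends_only_on_r \<epsilon> (\<lambda>x. 0)" by (auto simp: depends_only_on_r_def)
    ultimately show "\<exists>h. depends_only_on_r \<epsilon> h \<and> steady_gradient_rho_einstein_soliton \<rho> ?G h \<and>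
              (\<forall>x. scalar_curvature ?G x = 0)" using K by blast
  qed
qed

end
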